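(* There are infinitely many quartic Diophantine triples $\{a,b,c\}$ with $a>0$, $b>0$ and $c>0$.
   Context: A quartic Diophantine triple is a set $\{a,b,c\}$ of three distinct nonzero rational numbers such that $ab+1=r^4$, $ac+1=s^4$, $bc+1=t^4$ for some rational numbers $r,s,t$. *)

theory Defs
  imports Complex_Main
begin

definition quartic_diophantine_triple :: "rat set \<Rightarrow> bool" where
  "quartic_diophantine_triple T \<longleftrightarrow>
     (\<exists>a b c. T = {a, b, c} \<and> a \<noteq> b \<and> a \<noteq> c \<and> b \<noteq> c \<and> a \<noteq> 0 \<and> b \<noteq> 0 \<and> c \<noteq> 0 \<and>
        (\<exists>r s t. a * b + 1 = r ^ 4 \<and> a * c + 1 = s ^ 4 \<and> b * c + 1 = t ^ 4))"

end

theory Submission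
  imports Defs
begin

text \<open>
  The triple \<open>{5/(4y), 12y, 13y/4}\<close> has pairwise products \<open>15 = 2^4 - 1\<close>, \<open>65/16 = (3/2)^4 - 1\<close>
  and \<open>39y^2\<close>, so it remains to find infinitely many rational points on the genus one curve
  \<open>t^4 - 1 = 39y^2\<close>.  From the point with \<open>t = 5\<close>, \<open>y = 4\<close> the duplication formula of the lemniscatic
  cosine, \<open>t \<mapsto> (t^4 + 2t^2 - 1) / (1 + 2t^2 - t^4)\<close>, yields points of strictly increasing height.
\<close>

text \<open>The cofactor of \<open>t^4 - 1\<close> is a square, so the new abscissa stays on every
  curve \<open>t^4 - 1 = k * y^2\<close>, whatever \<open>k\<close> is.\<close>

lemma duplication_identity:
  fixes t :: "'a::field"
  assumes "1 + 2*t^2 - t^4 \<noteq> 0"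
  shows "((t^4 + 2*t^2 - 1) / (1 + 2*t^2 - t^4))^4 - 1
         = (t^4 - 1) * (4*t*(t^4 + 1) / (1 + 2*t^2 - t^4)^2)^2"
proof -
  define D where "D = 1 + 2*t^2 - t^4"
  have "D \<noteq> 0" using assms by (simp add: D_def)
  have "(t^4 + 2*t^2 - 1)^4 - D^4 = (t^4 - 1) * (4*t*(t^4 + 1))^2"
    unfolding D_def by algebra
  then have "(t^4 + 2*t^2 - 1)^4 / D^4 - 1 = (t^4 - 1) * (4*t*(t^4 + 1))^2 / D^4"
    using \<open>D \<noteq> 0\<close> by (simp add: divide_simps)
  then show ?thesis
    unfolding D_def[symmetric] by (simp add: power_divide flip: power_mult)
qed

text \<open>The two forms have sum \<open>4*p^2*q^2\<close> and difference
  \<open>2*(p^4 - q^4)\<close>, and \<open>p^2*q^2\<close> is coprime to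
  \<open>p^4 - q^4\<close>.\<close>

lemma duplication_common_divisor:
  fixes p q g :: int
  assumes "coprime p q"
    and "g dvd p^4 + 2*p^2*q^2 - q^4" "g dvd q^4 + 2*p^2*q^2 - p^4"
  shows "g dvd 4"
proof -
  have "coprime (p^2) (p^2 * p^2 + - (q^4))" "coprime (q^2) (- (q^2) * q^2 + p^4)"
    using assms(1) by (simp_all only: coprime_iff_gcd_eq_1 gcd_add_mult)
      (simp_all add: coprime_commute flip: coprime_iff_gcd_eq_1)
  then have "coprime (p^2 * q^2) (p^4 - q^4)"
    by (simp flip: power_add)
  moreover have "g dvd 4 * (p^2 * q^2)"
    using dvd_add[OF assms(2,3)] by (simp add: algebra_simps)
  moreover have "g dvd 4 * (p^4 - q^4)"
    using dvd_mult[OF dvd_diff[OF assms(2,3)], of 2] by (simp add: algebra_simps)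
  ultimately show ?thesis
    using gcd_greatest[of g "4 * (p^2 * q^2)" "4 * (p^4 - q^4)"]
    by (simp only: gcd_mult_left coprime_iff_gcd_eq_1) simp
qed

text \<open>With \<open>N\<close> and \<open>D\<close> the two quartic forms,
  \<open>N^2 + D^2 = 2*(p^4 + q^4)^2\<close>. Reducing the fraction of their absolute values cancels
  a factor of size at most 4, hence costs at most 16 in the sum of squares, which the quartic growth
  outweighs.\<close>

lemma duplication_height_less:
  fixes p q p' q' :: int
  assumes "coprime p q" "0 < q" "q < p" "coprime p' q'" "p' \<noteq> 0"
    and eq: "p' * \<bar>q^4 + 2*p^2*q^2 - p^4\<bar> = q' * \<bar>p^4 + 2*p^2*q^2 - q^4\<bar>"
  shows "p^2 + q^2 < p'^2 + q'^2"
proof -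
  define N D where "N = p^4 + 2*p^2*q^2 - q^4" and "D = q^4 + 2*p^2*q^2 - p^4"
  have eq': "p' * \<bar>D\<bar> = q' * \<bar>N\<bar>"
    using eq by (simp add: N_def D_def)
  then have "p' dvd \<bar>N\<bar>"
    using \<open>coprime p' q'\<close> by (metis coprime_dvd_mult_right_iff dvd_triv_left)
  then obtain g where N: "\<bar>N\<bar> = p' * g" by blast
  with eq' \<open>p' \<noteq> 0\<close> have D: "\<bar>D\<bar> = q' * g" by simp
  have "g dvd N" "g dvd D"
    using N D by (metis dvd_abs_iff dvd_triv_right)+
  then have "g dvd 4"
    using duplication_common_divisor[OF \<open>coprime p q\<close>] by (simp add: N_def D_def)
  then have "\<bar>g\<bar> \<le> 4" using zdvd_imp_le[of "\<bar>g\<bar>" 4] by simp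
  then have "g^2 \<le> 4^2" by (metis abs_le_square_iff abs_numeral)
  define H where "H = p^4 + q^4"
  have "2 * H^2 = \<bar>N\<bar>^2 + \<bar>D\<bar>^2"
    unfolding power2_abs by (simp add: H_def N_def D_def) algebra
  also have "\<dots> = g^2 * (p'^2 + q'^2)"
    unfolding N D by algebra
  also have "\<dots> \<le> 4^2 * (p'^2 + q'^2)"
    using \<open>g^2 \<le> 4^2\<close> by (intro mult_right_mono) auto
  finally have le: "H * H \<le> 8 * (p'^2 + q'^2)" by (simp add: power2_eq_square)
  have "p^2 \<le> p^4" "q^2 \<le> q^4"
    using assms(2,3) by (auto intro: power_increasing)
  \<comment> \<open>Since \<open>0 < q < p\<close>, \<open>p\<close> is at least 2; this pushes
    \<open>H\<close> past the constant 8 left over from 16/2.\<close>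
  moreover have "(2::int)^4 \<le> p^4" "1 \<le> q^4"
    using assms(2,3) by (intro power_mono one_le_power; simp)+
  ultimately have "p^2 + q^2 \<le> H" "8 < H" "0 < H" by (simp_all add: H_def)
  then have "8 * (p^2 + q^2) \<le> 8 * H" by simp
  also have "8 * H < H * H"
    using \<open>8 < H\<close> \<open>0 < H\<close> by (rule mult_strict_right_mono)
  also note le
  finally show ?thesis by simp
qed

text \<open>A sum of squares rather than a maximum, because duplication transforms it by an exact
  identity.\<close>

definition sq_height :: "rat \<Rightarrow> int" where
  "sq_height t = (fst (quotient_of t))^2 + (snd (quotient_of t))^2"

lemma ex_larger_height:
  fixes k t y :: rat
  assumes "1 < t" and t: "t^4 - 1 = k * y^2"
  shows "\<exists>t' y'. 1 < t' \<and> t'^4 - 1 = k * y'^2 \<and> sq_height t < sq_height t'"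
proof -
  obtain p q where pq: "quotient_of t = (p, q)" by fastforce
  then have "0 < q" "coprime p q" and t_eq: "t = of_int p / of_int q"
    using quotient_of_denom_pos quotient_of_coprime quotient_of_div by blast+
  have "q < p"
    using \<open>1 < t\<close> \<open>0 < q\<close> by (simp add: t_eq)
  define N D where "N = p^4 + 2*p^2*q^2 - q^4" and "D = q^4 + 2*p^2*q^2 - p^4"
  \<comment> \<open>If \<open>D\<close> vanished, \<open>N = 4*p^2*q^2\<close> would itself be a
    common divisor of both forms and so divide 4, forcing \<open>p\<close> to be a unit although
    \<open>p > q > 0\<close>.\<close>
  have "D \<noteq> 0"
  proof
    assume "D = 0"
    then have N: "N = 4 * (p^2 * q^2)" by (simp add: N_def D_def)
    then have "4 * (p^2 * q^2) dvd 4"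
      using duplication_common_divisor[OF \<open>coprime p q\<close>, of N] \<open>D = 0\<close>
      by (simp add: N_def[symmetric] D_def[symmetric])
    then have "p dvd 1"
      by (metis dvd_mult_cancel_left dvd_mult_left mult.right_neutral power2_eq_square
          zero_neq_numeral)
    then show False using \<open>0 < q\<close> \<open>q < p\<close> by simp
  qed
  have N_eq: "of_int N = (t^4 + 2*t^2 - 1) * of_int q ^ 4"
    and D_eq: "of_int D = (1 + 2*t^2 - t^4) * of_int q ^ 4"
    using \<open>0 < q\<close>
    by (simp_all add: N_def D_def t_eq field_simps power2_eq_square power4_eq_xxxx)
  \<comment> \<open>The quotient may be negative; its absolute value has the same fourth power, and
    \<open>1 < t'\<close> then follows from \<open>t'^4 > 1\<close>.\<close>
  define t' y' where "t' = \<bar>(t^4 + 2*t^2 - 1) / (1 + 2*t^2 - t^4)\<bar>"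
    and "y' = y * (4*t*(t^4 + 1) / (1 + 2*t^2 - t^4)^2)"
  have D0: "1 + 2*t^2 - t^4 \<noteq> 0"
    using D_eq \<open>D \<noteq> 0\<close> by auto
  have t'_eq: "t' = of_int \<bar>N\<bar> / of_int \<bar>D\<bar>"
    using \<open>0 < q\<close> by (simp add: t'_def N_eq D_eq abs_mult)
  have curve': "t'^4 - 1 = (t^4 - 1) * (4*t*(t^4 + 1) / (1 + 2*t^2 - t^4)^2)^2"
    using duplication_identity[OF D0] unfolding t'_def by (subst power_even_abs) simp_all
  moreover have "0 < t^4 - 1" "t * (t^4 + 1) \<noteq> 0"
    using \<open>1 < t\<close> by (auto simp: add_nonneg_eq_0_iff)
  ultimately have "0 < t'^4 - 1"
    using D0 by (simp only: zero_less_mult_iff zero_less_power2) simp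
  then have "1 < t'"
    by (metis diff_gt_0_iff_gt linorder_not_le power_le_one abs_ge_zero t'_def)
  have "t'^4 - 1 = k * y'^2"
    unfolding curve' t y'_def by (simp only: power_mult_distrib mult.assoc)
  obtain p' q' where pq': "quotient_of t' = (p', q')" by fastforce
  then have "0 < q'" "coprime p' q'" and t'_eq': "t' = of_int p' / of_int q'"
    using quotient_of_denom_pos quotient_of_coprime quotient_of_div by blast+
  have "p' \<noteq> 0" using \<open>1 < t'\<close> t'_eq' by auto
  have "(of_int (p' * \<bar>D\<bar>) :: rat) = of_int (q' * \<bar>N\<bar>)"
    using t'_eq t'_eq' \<open>0 < q'\<close> \<open>D \<noteq> 0\<close> by (simp add: field_simps)
  then have "p' * \<bar>D\<bar> = q' * \<bar>N\<bar>" by (simp only: of_int_eq_iff)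
  then have "p^2 + q^2 < p'^2 + q'^2"
    using duplication_height_less \<open>coprime p q\<close> \<open>0 < q\<close> \<open>q < p\<close> \<open>coprime p' q'\<close> \<open>p' \<noteq> 0\<close>
    by (simp add: N_def D_def)
  then have "sq_height t < sq_height t'"
    by (simp add: sq_height_def pq pq')
  with \<open>1 < t'\<close> \<open>t'^4 - 1 = k * y'^2\<close> show ?thesis by blast
qed

text \<open>A finite solution set would contain a point of maximal height, which
  \<open>ex_larger_height\<close> exceeds.\<close>

lemma infinite_quartic_points:
  fixes k t0 y0 :: rat
  assumes "1 < t0" "t0^4 - 1 = k * y0^2"
  shows "infinite {t. 1 < t \<and> (\<exists>y. t^4 - 1 = k * y^2)}" (is "infinite ?S")
proof
  assume fin: "finite ?S"
  have "t0 \<in> ?S" using assms by blast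
  with fin have "Max (sq_height ` ?S) \<in> sq_height ` ?S"
    by (intro Max_in) auto
  then obtain t y where t: "1 < t" "t^4 - 1 = k * y^2" "Max (sq_height ` ?S) = sq_height t"
    by (elim imageE) blast
  from ex_larger_height[OF t(1,2)] obtain t' where "t' \<in> ?S" "sq_height t < sq_height t'"
    by blast
  moreover have "sq_height t' \<le> Max (sq_height ` ?S)"
    using fin \<open>t' \<in> ?S\<close> by (intro Max_ge finite_imageI imageI)
  ultimately show False using t(3) by linarith
qed

theorem mainTheorem1:
  shows "infinite {{a, b, c} | a b c :: rat.
           quartic_diophantine_triple {a, b, c} \<and> a > 0 \<and> b > 0 \<and> c > 0}"
    (is "infinite ?T")
proof
  assume "finite ?T"
  \<comment> \<open>The values 2 and 3/2 are removed because there \<open>b * c\<close> would equal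
    \<open>a * b\<close> or \<open>a * c\<close>, making two members of the triple coincide.\<close>
  define S :: "rat set" where "S = {t. 1 < t \<and> (\<exists>y. t^4 - 1 = 39 * y^2)} - {2, 3/2}"
  have "infinite S"
    using infinite_quartic_points[of 5 39 4] by (simp add: S_def)
  moreover have "inj_on (\<lambda>t. t^4) S"
    by (intro inj_onI) (auto simp: S_def power_eq_iff_eq_base)
  ultimately have "infinite ((\<lambda>t. t^4) ` S)"
    by (simp add: finite_image_iff)
  \<comment> \<open>The product of the triple is \<open>195y/4\<close>, which determines \<open>t^4\<close>.\<close>
  moreover have "(\<lambda>t. t^4) ` S \<subseteq> (\<lambda>T. 39 * (4 * \<Prod>T / 195)^2 + 1) ` ?T"
  proof (rule image_subsetI)
    fix t assume "t \<in> S"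
    then obtain z where t: "1 < t" "t \<noteq> 2" "t \<noteq> 3/2" and z: "t^4 - 1 = 39 * z^2"
      by (auto simp: S_def)
    define y where "y = \<bar>z\<bar>"
    have "1 < t^4" using \<open>1 < t\<close> by simp
    with z have y: "t^4 = 39 * y^2 + 1" "0 < y" by (auto simp: y_def)
    define a b c where "a = 5 / (4 * y)" and "b = 12 * y" and "c = 13 * y / 4"
    have pos: "0 < a" "0 < b" "0 < c"
      using \<open>0 < y\<close> by (simp_all add: a_def b_def c_def)
    have prods: "a * b + 1 = 2^4" "a * c + 1 = (3/2)^4" "b * c + 1 = t^4"
      using y by (simp_all add: a_def b_def c_def power2_eq_square power4_eq_xxxx)
    have "t^4 \<noteq> 2^4" "t^4 \<noteq> (3/2)^4"
      using t power_eq_iff_eq_base[of 4 t 2] power_eq_iff_eq_base[of 4 t "3/2"] by auto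
    moreover have "(2::rat)^4 \<noteq> (3/2)^4" by (simp add: power_divide)
    \<comment> \<open>Two equal members would give two equal pairwise products, but the three fourth
      powers are distinct.\<close>
    ultimately have "a \<noteq> b" "a \<noteq> c" "b \<noteq> c"
      using prods by (metis mult.commute)+
    then have "{a, b, c} \<in> ?T"
      using pos prods unfolding quartic_diophantine_triple_def by blast
    moreover have "t^4 = 39 * (4 * \<Prod>{a, b, c} / 195)^2 + 1"
      using \<open>a \<noteq> b\<close> \<open>a \<noteq> c\<close> \<open>b \<noteq> c\<close> y by (simp add: a_def b_def c_def)
    ultimately show "t^4 \<in> (\<lambda>T. 39 * (4 * \<Prod>T / 195)^2 + 1) ` ?T"
      by (rule rev_image_eqI)
  qed
  ultimately show False
    using \<open>finite ?T\<close> finite_surj by blast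
qed

end
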